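(* Let $\beta,\beta'$ be two observers in Minkowski spacetime, let $U$ be the 4-velocity of $\beta$, let $S$ be the relative position of $\beta'$ with respect to $\beta$, and let $V_{\mathrm{Fermi}}$ and $V_{\mathrm{kin}}$ be the Fermi relative velocity and the kinematic relative velocity of $\beta'$ with respect to $\beta$. Then, along $\beta$, $$V_{\mathrm{Fermi}}=\bigl(1+g(S,\nabla_U U)\bigr)\,V_{\mathrm{kin}}.$$
   Context: Minkowski spacetime is the 4-dimensional affine space with flat metric $g$ of signature $(-,+,+,+)$, $c=1$, with a fixed time orientation; $\nabla$ is the Levi-Civita connection (so, for a vector field $X$ along $\beta$ with $\beta$ parameterized by proper time $\tau$, $\nabla_U X=\frac{dX}{d\tau}$). For events $p,q$, $q-p$ denotes the vector joining $p$ to $q$. An observer is a (smooth) future-directed timelike curve $\beta:I\to\mathcal M$, with $I\subset\mathbb R$ an interval, parameterized by proper time and identified with its image; its 4-velocity $U$ is its tangent field, which satisfies $g(U,U)=-1$. $U'$ denotes the 4-velocity of $\beta'$. For an event $p$ and a future-pointing timelike unit vector $u$ at $p$, $L_{p,u}=\{q : g(q-p,u)=0\}$. Relative position: it is assumed that for every $p\in\beta$ there is a unique event $q$ of $\beta'\cap L_{p,U_p}$. The relative position of $\beta'$ with respect to $\beta$ is the vector field $S$ along $\beta$ given by $S_p=q-p$. Fermi relative velocity of $\beta'$ with respect to $\beta$: $V_{\mathrm{Fermi}}:=\nabla_U S+g(\nabla_U S,U)\,U$, a vector field along $\beta$. Kinematic relative velocity of $\beta'$ with respect to $\beta$: the vector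 field along $\beta$ given at $p\in\beta$ by $$V_{\mathrm{kin}\,p}:=\frac{1}{-g(\tau_{qp}U'_q,U_p)}\,\tau_{qp}U'_q-U_p,$$ where $q$ is the unique event of $\beta'\cap L_{p,U_p}$ and $\tau_{qp}$ is parallel transport from $q$ to $p$ along the geodesic joining them (in Minkowski spacetime, the identification of vectors at $q$ and at $p$ by the affine structure). *)

theory Defs
  imports "HOL-Analysis.Analysis"
begin

text \<open>
  Minkowski spacetime in inertial coordinates \<open>(t, x)\<close> with \<open>c = 1\<close>. Events and tangent vectors
  (at any event) share this type, and \<open>q - p\<close> is the vector joining \<open>p\<close> to \<open>q\<close>.
\<close>
type_synonym spacetime = "real \<times> (real ^ 3)"

definition mink :: "spacetime \<Rightarrow> spacetime \<Rightarrow> real" where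
  "mink v w = - (fst v * fst w) + snd v \<bullet> snd w"

definition future_timelike :: "spacetime \<Rightarrow> bool" where
  "future_timelike v \<longleftrightarrow> mink v v < 0 \<and> fst v > 0"

text \<open>
  Differentiability of all orders on an interval that may contain its end points; there the
  derivatives are one-sided. \<open>D n\<close> is the \<open>n\<close>-th derivative.
\<close>
definition smooth_curve_on :: "real set \<Rightarrow> (real \<Rightarrow> spacetime) \<Rightarrow> bool" where
  "smooth_curve_on I \<beta> \<longleftrightarrow>
     (\<exists>D :: nat \<Rightarrow> real \<Rightarrow> spacetime. (\<forall>\<tau>\<in>I. D 0 \<tau> = \<beta> \<tau>) \<and>
        (\<forall>n. \<forall>\<tau>\<in>I. (D n has_vector_derivative D (Suc n) \<tau>) (at \<tau> within I)))"

text \<open>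
  Vector fields along a curve \<open>\<beta>\<close> on \<open>I\<close> are functions of its parameter \<open>\<tau>\<close>.
\<close>
definition four_velocity :: "real set \<Rightarrow> (real \<Rightarrow> spacetime) \<Rightarrow> real \<Rightarrow> spacetime" where
  "four_velocity I \<beta> \<tau> = vector_derivative \<beta> (at \<tau> within I)"

text \<open>
  The operator \<open>\<nabla>\<^sub>U\<close> on vector fields along a curve on \<open>I\<close> with proper time \<open>\<tau>\<close>: the connection
  is flat and the coordinates are affine, so it is \<open>d/d\<tau>\<close>.
\<close>
definition cov_deriv :: "real set \<Rightarrow> (real \<Rightarrow> spacetime) \<Rightarrow> real \<Rightarrow> spacetime" where
  "cov_deriv I X \<tau> = vector_derivative X (at \<tau> within I)"

text \<open>Intervals are required to have more than one point, so that tangents are determined.\<close>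
definition observer :: "real set \<Rightarrow> (real \<Rightarrow> spacetime) \<Rightarrow> bool" where
  "observer I \<beta> \<longleftrightarrow>
     is_interval I \<and> (\<exists>a\<in>I. \<exists>b\<in>I. a < b) \<and> smooth_curve_on I \<beta> \<and>
     (\<forall>\<tau>\<in>I. future_timelike (four_velocity I \<beta> \<tau>) \<and>
            mink (four_velocity I \<beta> \<tau>) (four_velocity I \<beta> \<tau>) = - 1)"

text \<open>
  The 4-velocity as a vector field on the image of \<open>\<beta>\<close>; observers are injective because their
  time coordinate is strictly increasing.
\<close>
definition four_velocity_at :: "real set \<Rightarrow> (real \<Rightarrow> spacetime) \<Rightarrow> spacetime \<Rightarrow> spacetime" where
  "four_velocity_at I \<beta> q = four_velocity I \<beta> (the_inv_into I \<beta> q)"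

definition simultaneity :: "spacetime \<Rightarrow> spacetime \<Rightarrow> spacetime set" where
  "simultaneity p u = {q. mink (q - p) u = 0}"

text \<open>The standing assumption under which the relative position is defined.\<close>
definition has_relative_position ::
  "real set \<Rightarrow> (real \<Rightarrow> spacetime) \<Rightarrow> real set \<Rightarrow> (real \<Rightarrow> spacetime) \<Rightarrow> bool" where
  "has_relative_position I \<beta> I' \<beta>' \<longleftrightarrow>
     (\<forall>\<tau>\<in>I. \<exists>!q. q \<in> \<beta>' ` I' \<inter> simultaneity (\<beta> \<tau>) (four_velocity I \<beta> \<tau>))"

definition simultaneous_event ::
  "real set \<Rightarrow> (real \<Rightarrow> spacetime) \<Rightarrow> real set \<Rightarrow> (real \<Rightarrow> spacetime) \<Rightarrow> real \<Rightarrow> spacetime" where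
  "simultaneous_event I \<beta> I' \<beta>' \<tau> =
     (THE q. q \<in> \<beta>' ` I' \<inter> simultaneity (\<beta> \<tau>) (four_velocity I \<beta> \<tau>))"

definition relative_position ::
  "real set \<Rightarrow> (real \<Rightarrow> spacetime) \<Rightarrow> real set \<Rightarrow> (real \<Rightarrow> spacetime) \<Rightarrow> real \<Rightarrow> spacetime" where
  "relative_position I \<beta> I' \<beta>' \<tau> = simultaneous_event I \<beta> I' \<beta>' \<tau> - \<beta> \<tau>"

definition V_Fermi ::
  "real set \<Rightarrow> (real \<Rightarrow> spacetime) \<Rightarrow> real set \<Rightarrow> (real \<Rightarrow> spacetime) \<Rightarrow> real \<Rightarrow> spacetime" where
  "V_Fermi I \<beta> I' \<beta>' \<tau> =
     (let U = four_velocity I \<beta> \<tau>;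
          DS = cov_deriv I (relative_position I \<beta> I' \<beta>') \<tau>
      in DS + mink DS U *\<^sub>R U)"

text \<open>
  Parallel transport from \<open>q\<close> to \<open>p\<close>; by flatness it is the affine identification of the tangent
  spaces, which is the identity in this representation.
\<close>
definition parallel_transport :: "spacetime \<Rightarrow> spacetime \<Rightarrow> spacetime \<Rightarrow> spacetime" where
  "parallel_transport q p v = v"

definition V_kin ::
  "real set \<Rightarrow> (real \<Rightarrow> spacetime) \<Rightarrow> real set \<Rightarrow> (real \<Rightarrow> spacetime) \<Rightarrow> real \<Rightarrow> spacetime" where
  "V_kin I \<beta> I' \<beta>' \<tau> =
     (let U = four_velocity I \<beta> \<tau>;
          q = simultaneous_event I \<beta> I' \<beta>' \<tau>;
          W = parallel_transport q (\<beta> \<tau>) (four_velocity_at I' \<beta>' q)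
      in (1 / (- mink W U)) *\<^sub>R W - U)"

end

theory Submission
  imports Defs
begin

text \<open>
  Write \<open>\<sigma> \<tau>\<close> for the parameter on \<open>\<beta>'\<close> of the event simultaneous with \<open>\<beta> \<tau>\<close>. The reversed
  Cauchy-Schwarz inequality \<open>g(U', U) \<le> -1\<close> makes \<open>s \<mapsto> g(\<beta>' s - \<beta> \<tau>, U \<tau>)\<close> expand distances by a
  factor at least \<open>1\<close>, so its zero \<open>\<sigma> \<tau>\<close> depends continuously, and then differentiably, on \<open>\<tau>\<close>,
  with \<open>\<sigma>' = - (1 + g(S, \<nabla>\<^sub>U U)) / g(U', U)\<close>. No implicit function theorem is used, because
  either parameter may be an end point of its interval. From \<open>\<nabla>\<^sub>U S = \<sigma>' U' - U\<close> the claim is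
  linear algebra.
\<close>

text \<open>Boundedness gives the indefinite form \<open>mink\<close> the limit and product rules of
  a continuous bilinear product, through the interpretation that follows.\<close>

lemma bounded_bilinear_mink: "bounded_bilinear mink"
proof -
  have a: "bounded_bilinear (\<lambda>(v :: spacetime) (w :: spacetime). fst v * fst w)"
    by (rule bounded_bilinear.comp[OF bounded_bilinear_mult bounded_linear_fst bounded_linear_fst])
  have b: "bounded_bilinear (\<lambda>(v :: spacetime) (w :: spacetime). snd v \<bullet> snd w)"
    by (rule bounded_bilinear.comp[OF bounded_bilinear_inner bounded_linear_snd bounded_linear_snd])
  obtain K L where K: "\<And>(v :: spacetime) (w :: spacetime). norm (fst v * fst w) \<le> norm v * norm w * K"
    and L: "\<And>(v :: spacetime) (w :: spacetime). norm (snd v \<bullet> snd w) \<le> norm v * norm w * L"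
    using bounded_bilinear.bounded[OF a] bounded_bilinear.bounded[OF b] by blast
  have "norm (mink v w) \<le> norm v * norm w * (K + L)" for v w
    using K[of v w] L[of v w] by (simp add: mink_def distrib_left)
  then have "\<exists>C. \<forall>v w. norm (mink v w) \<le> norm v * norm w * C"
    by blast
  then show ?thesis
    by unfold_locales (assumption | simp add: mink_def algebra_simps)+
qed

interpretation mink: bounded_bilinear mink
  by (rule bounded_bilinear_mink)

text \<open>For unit vectors the time components are sqrt (1 + a^2) and sqrt (1 + b^2), with a, b
  the lengths of the spatial parts. The identity (1 + a^2)(1 + b^2) = (1 + a b)^2 + (a - b)^2 bounds
  their product below by 1 + a b, and ordinary Cauchy-Schwarz bounds the spatial product above by a
  b.\<close>

lemma mink_le_minus_one:
  assumes "future_timelike v" "mink v v = -1" "future_timelike w" "mink w w = -1"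
  shows "mink v w \<le> -1"
proof -
  define a b where "a = norm (snd v)" and "b = norm (snd w)"
  have v: "fst v > 0" "(fst v)\<^sup>2 = 1 + a\<^sup>2" and w: "fst w > 0" "(fst w)\<^sup>2 = 1 + b\<^sup>2"
    using assms by (auto simp: future_timelike_def mink_def a_def b_def power2_eq_square
        simp flip: power2_norm_eq_inner)
  have "(1 + a * b)\<^sup>2 \<le> (1 + a * b)\<^sup>2 + (a - b)\<^sup>2"
    by simp
  also have "\<dots> = (1 + a\<^sup>2) * (1 + b\<^sup>2)"
    by (simp add: power2_eq_square algebra_simps)
  also have "\<dots> = (fst v * fst w)\<^sup>2"
    by (simp add: v w power_mult_distrib)
  finally have "1 + a * b \<le> fst v * fst w"
    by (rule power2_le_imp_le) (use v w in simp)
  moreover have "snd v \<bullet> snd w \<le> a * b"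
    unfolding a_def b_def by (rule norm_cauchy_schwarz)
  ultimately show ?thesis
    by (simp add: mink_def)
qed

text \<open>Caratheodory's form of the derivative: \<phi> is the difference quotient, filled in with
  \<open>D\<close> at \<open>x\<close>. Its equation contains no division, so it can be evaluated at
  a parameter that may coincide with the base point.\<close>

lemma has_vector_derivative_caratheodory:
  assumes "(f has_vector_derivative D) (at x within S)"
  obtains \<phi> where "\<And>y. f y - f x = (y - x) *\<^sub>R \<phi> y" "\<phi> x = D" "continuous (at x within S) \<phi>"
proof
  define \<phi> where "\<phi> y = (if y = x then D else (f y - f x) /\<^sub>R (y - x))" for y
  show "f y - f x = (y - x) *\<^sub>R \<phi> y" for y
    by (simp add: \<phi>_def)
  show "\<phi> x = D"
    by (simp add: \<phi>_def)
  have "((\<lambda>y. norm ((f y - f x) - (y - x) *\<^sub>R D) / norm (y - x)) \<longlongrightarrow> 0) (at x within S)"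
    using assms by (simp add: has_vector_derivative_def has_derivative_iff_norm)
  moreover have "norm ((f y - f x) - (y - x) *\<^sub>R D) / norm (y - x) = norm (\<phi> y - D)"
    if "y \<noteq> x" for y
  proof -
    have "(f y - f x) - (y - x) *\<^sub>R D = (y - x) *\<^sub>R (\<phi> y - D)"
      using that by (simp add: \<phi>_def scaleR_diff_right)
    then show ?thesis
      using that by simp
  qed
  ultimately have "((\<lambda>y. norm (\<phi> y - D)) \<longlongrightarrow> 0) (at x within S)"
    by (subst (asm) Lim_cong_within) auto
  then show "continuous (at x within S) \<phi>"
    unfolding continuous_within using \<open>\<phi> x = D\<close> by (simp add: LIM_zero_iff tendsto_norm_zero_iff)
qed

lemma observer_at_within_neq_bot:
  assumes "observer I \<beta>" "\<tau> \<in> I"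
  shows "at \<tau> within I \<noteq> bot"
proof -
  have "connected I" "\<And>x. I \<noteq> {x}"
    using assms by (auto simp: observer_def is_interval_connected)
  then show ?thesis
    using connected_imp_perfect assms(2) by (metis trivial_limit_within)
qed

text \<open>\<open>four_velocity\<close> and \<open>cov_deriv\<close> are defined by choice. A
  nondegenerate interval has no isolated points, so derivatives within it are unique, end points
  included, and the choices agree with the witnesses \<open>D 1\<close> and \<open>D 2\<close> of
  smoothness.\<close>

lemma observer_derivatives:
  assumes "observer I \<beta>" "\<tau> \<in> I"
  shows "(\<beta> has_vector_derivative four_velocity I \<beta> \<tau>) (at \<tau> within I)"
    and "(four_velocity I \<beta> has_vector_derivative cov_deriv I (four_velocity I \<beta>) \<tau>)
           (at \<tau> within I)"
proof -
  obtain D where D0: "\<And>t. t \<in> I \<Longrightarrow> D 0 t = \<beta> t"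
    and D: "\<And>n t. t \<in> I \<Longrightarrow> (D n has_vector_derivative D (Suc n) t) (at t within I)"
    using assms(1) unfolding observer_def smooth_curve_on_def by blast
  have \<beta>: "(\<beta> has_vector_derivative D 1 t) (at t within I)" if "t \<in> I" for t
    using has_vector_derivative_transform[OF that _ D[OF that, of 0], of \<beta>] D0 by simp
  have U: "four_velocity I \<beta> t = D 1 t" if "t \<in> I" for t
    unfolding four_velocity_def
    using vector_derivative_within[OF observer_at_within_neq_bot[OF assms(1) that] \<beta>[OF that]] .
  show "(\<beta> has_vector_derivative four_velocity I \<beta> \<tau>) (at \<tau> within I)"
    using \<beta> U assms(2) by simp
  have "(four_velocity I \<beta> has_vector_derivative D (Suc 1) \<tau>) (at \<tau> within I)"
    using has_vector_derivative_transform[OF assms(2) _ D[OF assms(2), of 1]] U by simp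
  with vector_derivative_within[OF observer_at_within_neq_bot[OF assms] this]
  show "(four_velocity I \<beta> has_vector_derivative cov_deriv I (four_velocity I \<beta>) \<tau>)
           (at \<tau> within I)"
    by (simp add: cov_deriv_def)
qed

text \<open>Mean value theorem: along \<beta>' the function \<open>mink (\<beta>' r) u\<close> has
  derivative g(U', u) \<le> -1.\<close>

lemma observer_mink_expanding:
  assumes obs: "observer I' \<beta>'" and u: "future_timelike u" "mink u u = -1"
    and st: "s \<in> I'" "t \<in> I'"
  shows "\<bar>s - t\<bar> \<le> \<bar>mink (\<beta>' s - \<beta>' t) u\<bar>"
  using st
proof (induction s t rule: linorder_wlog)
  case (le a b)
  have "{a..b} \<subseteq> I'"
    using obs le unfolding observer_def is_interval_1 by (meson atLeastAtMost_iff subsetI)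
  then have "((\<lambda>r. mink (\<beta>' r) u) has_derivative (\<lambda>h. h * mink (four_velocity I' \<beta>' r) u))
      (at r within {a..b})" if "a \<le> r" "r \<le> b" for r
    using that mink.has_vector_derivative[OF
        has_vector_derivative_within_subset[OF observer_derivatives(1)[OF obs, of r]]
        has_vector_derivative_const, of "{a..b}" u]
    by (auto simp: has_vector_derivative_def mink.zero_right)
  from mvt_very_simple[OF le(1) this]
  obtain r where r: "r \<in> {a..b}"
    "mink (\<beta>' b) u - mink (\<beta>' a) u = (b - a) * mink (four_velocity I' \<beta>' r) u"
    by blast
  have "mink (four_velocity I' \<beta>' r) u \<le> -1"
    using obs u r \<open>{a..b} \<subseteq> I'\<close> by (intro mink_le_minus_one) (auto simp: observer_def)
  then have "(b - a) * 1 \<le> (b - a) * - mink (four_velocity I' \<beta>' r) u"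
    using le(1) by (intro mult_left_mono) auto
  then show ?case
    using r le(1) by (simp add: mink.diff_left)
next
  case (sym a b)
  then show ?case
    by (simp add: mink.diff_left abs_minus_commute)
qed

lemma observer_inj_on:
  assumes "observer I \<beta>"
  shows "inj_on \<beta> I"
proof (rule inj_onI)
  fix s t assume st: "s \<in> I" "t \<in> I" "\<beta> s = \<beta> t"
  have "\<bar>s - t\<bar> \<le> \<bar>mink (\<beta> s - \<beta> t) (four_velocity I \<beta> s)\<bar>"
    using assms st by (intro observer_mink_expanding[OF assms]) (auto simp: observer_def)
  then show "s = t"
    using st by (simp add: mink.zero_left)
qed

text \<open>Implicit differentiation of the simultaneity equation by hand: first continuity of
  \<sigma> from the expansion bound, then the limit of its difference quotient.\<close>

lemma simultaneous_parameter_has_derivative: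
  assumes obs: "observer I \<beta>" and obs': "observer I' \<beta>'"
    and \<sigma>: "\<And>t. t \<in> I \<Longrightarrow> \<sigma> t \<in> I'"
    and sim: "\<And>t. t \<in> I \<Longrightarrow> mink (\<beta>' (\<sigma> t) - \<beta> t) (four_velocity I \<beta> t) = 0"
    and x: "x \<in> I"
  shows "(\<sigma> has_real_derivative
      - (1 + mink (\<beta>' (\<sigma> x) - \<beta> x) (cov_deriv I (four_velocity I \<beta>) x)) /
        mink (four_velocity I' \<beta>' (\<sigma> x)) (four_velocity I \<beta> x)) (at x within I)"
proof -
  let ?U = "four_velocity I \<beta>" and ?U' = "four_velocity I' \<beta>' (\<sigma> x)"
  have U: "future_timelike (?U t)" "mink (?U t) (?U t) = -1" if "t \<in> I" for t
    using obs that by (auto simp: observer_def)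
  \<comment> \<open>The event on \<beta>' is frozen at parameter \<open>\<sigma> x\<close>, so
    \<open>F\<close> varies only through \<beta> and its 4-velocity. In its derivative
    \<open>c\<close> the summand 1 is -g(U, U).\<close>
  define F where "F t = mink (\<beta>' (\<sigma> x) - \<beta> t) (?U t)" for t
  define c where "c = 1 + mink (\<beta>' (\<sigma> x) - \<beta> x) (cov_deriv I ?U x)"
  have "((\<lambda>t. \<beta>' (\<sigma> x) - \<beta> t) has_vector_derivative - ?U x) (at x within I)"
    using has_vector_derivative_diff[OF has_vector_derivative_const observer_derivatives(1)[OF obs x]]
    by simp
  from mink.has_vector_derivative[OF this observer_derivatives(2)[OF obs x]]
  have "(F has_vector_derivative c) (at x within I)"
    using U(2)[OF x] by (simp add: F_def[abs_def] c_def mink.minus_left algebra_simps)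
  then have F: "(F has_real_derivative c) (at x within I)"
    by (simp add: has_real_derivative_iff_has_vector_derivative)
  have Fx: "F x = 0"
    using sim x by (simp add: F_def)
  \<comment> \<open>Subtracting the simultaneity equation at \<open>t\<close> moves all the
    variation onto \<beta>'; this links increments of \<open>F\<close> to increments of
    \<sigma>.\<close>
  have F_eq: "F t = - mink (\<beta>' (\<sigma> t) - \<beta>' (\<sigma> x)) (?U t)" if "t \<in> I" for t
    using sim[OF that] by (simp add: F_def mink.diff_left)
  have \<sigma>_le: "\<bar>\<sigma> t - \<sigma> x\<bar> \<le> \<bar>F t\<bar>" if "t \<in> I" for t
    using observer_mink_expanding[OF obs' U[OF that] \<sigma>[OF that] \<sigma>[OF x]] F_eq[OF that] by simp
  have "(F \<longlongrightarrow> 0) (at x within I)"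
    using DERIV_continuous[OF F] Fx by (simp add: continuous_within)
  then have "((\<lambda>t. \<sigma> t - \<sigma> x) \<longlongrightarrow> 0) (at x within I)"
    by (rule Lim_null_comparison[rotated, OF tendsto_rabs_zero])
      (auto simp: eventually_at_filter \<sigma>_le)
  then have cont: "continuous (at x within I) \<sigma>"
    by (simp add: continuous_within LIM_zero_iff)
  \<comment> \<open>With this factor, F t = -(\<sigma> t - \<sigma> x) g(\<phi> (\<sigma> t), U t),
    valid also where \<open>\<sigma> t = \<sigma> x\<close>.\<close>
  obtain \<phi> where \<phi>: "\<And>y. \<beta>' y - \<beta>' (\<sigma> x) = (y - \<sigma> x) *\<^sub>R \<phi> y" "\<phi> (\<sigma> x) = ?U'"
    and "continuous (at (\<sigma> x) within I') \<phi>"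
    using has_vector_derivative_caratheodory[OF observer_derivatives(1)[OF obs' \<sigma>[OF x]]] by blast
  then have "continuous (at (\<sigma> x) within \<sigma> ` I) \<phi>"
    using \<sigma> by (blast intro: continuous_within_subset)
  from continuous_within_compose[OF cont this]
  have "((\<lambda>t. \<phi> (\<sigma> t)) \<longlongrightarrow> ?U') (at x within I)"
    using \<phi>(2) by (simp add: continuous_within o_def)
  moreover have "(?U \<longlongrightarrow> ?U x) (at x within I)"
    using has_vector_derivative_continuous[OF observer_derivatives(2)[OF obs x]]
    by (simp add: continuous_within)
  ultimately have g: "((\<lambda>t. mink (\<phi> (\<sigma> t)) (?U t)) \<longlongrightarrow> mink ?U' (?U x)) (at x within I)"
    by (rule mink.tendsto)
  have neg: "mink ?U' (?U x) \<le> -1"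
    using obs obs' x \<sigma> by (intro mink_le_minus_one) (auto simp: observer_def)
  have "((\<lambda>t. - ((F t - F x) / (t - x)) / mink (\<phi> (\<sigma> t)) (?U t)) \<longlongrightarrow> - c / mink ?U' (?U x))
      (at x within I)"
    using F g neg unfolding has_field_derivative_iff by (intro tendsto_intros) auto
  moreover have "\<forall>\<^sub>F t in at x within I.
      - ((F t - F x) / (t - x)) / mink (\<phi> (\<sigma> t)) (?U t) = (\<sigma> t - \<sigma> x) / (t - x)"
  proof -
    \<comment> \<open>The limit g(U', U) is at most -1, so the factor stays nonzero near
      \<open>x\<close> and may be cancelled.\<close>
    have "\<forall>\<^sub>F t in at x within I. mink (\<phi> (\<sigma> t)) (?U t) < 0"
      using g neg by (intro order_tendstoD(2)) auto
    moreover have "\<forall>\<^sub>F t in at x within I. t \<in> I"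
      by (simp add: eventually_at_filter)
    ultimately show ?thesis
    proof eventually_elim
      case (elim t)
      then show ?case
        using F_eq[of t] by (simp add: Fx \<phi>(1) mink.scaleR_left)
    qed
  qed
  ultimately show ?thesis
    unfolding has_field_derivative_iff c_def by (rule Lim_transform_eventually)
qed

theorem corollary5p1:
  fixes I I' :: "real set" and \<beta> \<beta>' :: "real \<Rightarrow> spacetime"
  assumes "observer I \<beta>" and "observer I' \<beta>'"
    and "has_relative_position I \<beta> I' \<beta>'"
  shows "\<forall>\<tau>\<in>I. V_Fermi I \<beta> I' \<beta>' \<tau> =
           (1 + mink (relative_position I \<beta> I' \<beta>' \<tau>) (cov_deriv I (four_velocity I \<beta>) \<tau>))
             *\<^sub>R V_kin I \<beta> I' \<beta>' \<tau>"
proof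
  fix x assume x: "x \<in> I"
  let ?U = "four_velocity I \<beta>"
  let ?q = "simultaneous_event I \<beta> I' \<beta>'"
  have q: "?q t \<in> \<beta>' ` I' \<inter> simultaneity (\<beta> t) (?U t)" if "t \<in> I" for t
    unfolding simultaneous_event_def
    by (rule theI') (use assms(3) that in \<open>simp add: has_relative_position_def\<close>)
  \<comment> \<open>This is the same inverse that \<open>four_velocity_at\<close> uses, so the
    vector transported in \<open>V_kin\<close> is the 4-velocity of \<beta>' at parameter
    \<open>\<sigma> t\<close>.\<close>
  define \<sigma> where "\<sigma> t = the_inv_into I' \<beta>' (?q t)" for t
  have inj: "inj_on \<beta>' I'"
    by (rule observer_inj_on[OF assms(2)])
  have \<sigma>: "\<sigma> t \<in> I'" and \<beta>'\<sigma>: "\<beta>' (\<sigma> t) = ?q t" if "t \<in> I" for t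
    unfolding \<sigma>_def
    using q[OF that] the_inv_into_into[OF inj, of "?q t" I'] f_the_inv_into_f[OF inj, of "?q t"]
    by auto
  have sim: "mink (\<beta>' (\<sigma> t) - \<beta> t) (?U t) = 0" if "t \<in> I" for t
    using q[OF that] \<beta>'\<sigma>[OF that] by (simp add: simultaneity_def)
  define U where "U = ?U x"
  define U' where "U' = four_velocity I' \<beta>' (\<sigma> x)"
  define c where "c = 1 + mink (relative_position I \<beta> I' \<beta>' x) (cov_deriv I ?U x)"
  define d where "d = - c / mink U' U"
  have UU: "mink U U = -1" and U'U: "mink U' U \<le> -1"
    using assms(1,2) x \<sigma>[OF x] unfolding U_def U'_def observer_def
    by (auto intro!: mink_le_minus_one)
  have "(\<sigma> has_real_derivative d) (at x within I)"
    using simultaneous_parameter_has_derivative[OF assms(1,2) \<sigma> sim x] \<beta>'\<sigma>[OF x]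
    by (simp add: d_def c_def U_def U'_def relative_position_def)
  then have "(\<sigma> has_vector_derivative d) (at x within I)"
    by (simp add: has_real_derivative_iff_has_vector_derivative)
  moreover have "(\<beta>' has_vector_derivative U') (at (\<sigma> x) within \<sigma> ` I)"
    unfolding U'_def using \<sigma> x
    by (blast intro: has_vector_derivative_within_subset[OF observer_derivatives(1)[OF assms(2)]])
  ultimately have "(\<beta>' \<circ> \<sigma> has_vector_derivative d *\<^sub>R U') (at x within I)"
    by (rule vector_diff_chain_within)
  from has_vector_derivative_diff[OF this observer_derivatives(1)[OF assms(1) x]]
  have "((\<lambda>t. (\<beta>' \<circ> \<sigma>) t - \<beta> t) has_vector_derivative d *\<^sub>R U' - U) (at x within I)"
    by (simp add: U_def)
  then have "(relative_position I \<beta> I' \<beta>' has_vector_derivative d *\<^sub>R U' - U) (at x within I)"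
    by (rule has_vector_derivative_transform[OF x, rotated])
      (simp add: relative_position_def \<beta>'\<sigma>)
  then have DS: "cov_deriv I (relative_position I \<beta> I' \<beta>') x = d *\<^sub>R U' - U"
    unfolding cov_deriv_def
    by (rule vector_derivative_within[OF observer_at_within_neq_bot[OF assms(1) x]])
  \<comment> \<open>The summand 1 is -g(U, U), coming from the term -U of the derivative of S; it
    cancels that term in the next step.\<close>
  have "V_Fermi I \<beta> I' \<beta>' x = d *\<^sub>R U' - U + (d * mink U' U + 1) *\<^sub>R U"
    by (simp add: V_Fermi_def DS mink.diff_left mink.scaleR_left UU flip: U_def)
  also have "\<dots> = d *\<^sub>R U' + (d * mink U' U) *\<^sub>R U"
    by (simp add: algebra_simps)
  \<comment> \<open>By the choice of \<open>d\<close>, d g(U', U) = -c, so \<open>c\<close> factors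
    out of both terms.\<close>
  also have "\<dots> = c *\<^sub>R ((1 / (- mink U' U)) *\<^sub>R U' - U)"
    using U'U by (simp add: d_def scaleR_diff_right)
  also have "(1 / (- mink U' U)) *\<^sub>R U' - U = V_kin I \<beta> I' \<beta>' x"
    by (simp add: V_kin_def Let_def parallel_transport_def four_velocity_at_def U_def U'_def \<sigma>_def)
  finally show "V_Fermi I \<beta> I' \<beta>' x =
      (1 + mink (relative_position I \<beta> I' \<beta>' x) (cov_deriv I ?U x)) *\<^sub>R V_kin I \<beta> I' \<beta>' x"
    by (simp add: c_def)
qed

end
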